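(* If $\mathcal{C}$ is an $\mathsf{HUCW}$ class of graphs that does not contain (as a subclass) any minimal $\mathsf{HUCW}$ class, then there exists in $\mathcal{C}$ an antichain (under the induced subgraph relation) of unbounded clique-width.
   Context: Graphs are finite, simple, undirected. A class is hereditary if closed under induced subgraphs; it has unbounded clique-width if there is no uniform bound on the clique-width of its members. A class is $\mathsf{HUCW}$ if it is hereditary and of unbounded clique-width, and minimal $\mathsf{HUCW}$ if it is $\mathsf{HUCW}$ and no proper subclass of it is $\mathsf{HUCW}$. An antichain is a set of graphs no two distinct members of which are related by the induced subgraph relation; it has unbounded clique-width if the clique-widths of its members are unbounded. *)

theory Defs
  imports "Graph_Theory.Graph_Theory"
begin

text \<open>
  A finite simple undirected graph is a \<^locale>\<open>pair_graph\<close>: each edge $uv$ is represented by the two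
  arcs $(u,v)$ and $(v,u)$. The null graph is allowed. Up to isomorphism, all finite graphs are obtained
  with \<^typ>\<open>nat\<close> as the type of vertices.
\<close>

text \<open>The induced subgraph relation is taken up to isomorphism.\<close>

definition ind_subgraph :: "'a pair_pre_digraph \<Rightarrow> 'a pair_pre_digraph \<Rightarrow> bool" where
  "ind_subgraph H G \<longleftrightarrow>
     (\<exists>H' :: 'a pair_pre_digraph.
        induced_subgraph (with_proj H') (with_proj G) \<and> digraph_iso (with_proj H) (with_proj H'))"

text \<open>
  \<open>cw_constructible k G l\<close>: the graph \<open>G\<close>, with each vertex \<open>v\<close> carrying the label \<open>l v\<close>, can be built
  with labels from $\{0,\dots,k-1\}$. Values of \<open>l\<close> outside \<open>pverts G\<close> are irrelevant.
\<close>

inductive cw_constructible :: "nat \<Rightarrow> 'a pair_pre_digraph \<Rightarrow> ('a \<Rightarrow> nat) \<Rightarrow> bool" for k :: nat where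
  create: "i < k \<Longrightarrow> cw_constructible k \<lparr>pverts = {v}, parcs = {}\<rparr> (\<lambda>_. i)"
| disjoint_union:
    "cw_constructible k G l \<Longrightarrow> cw_constructible k H m \<Longrightarrow> pverts G \<inter> pverts H = {} \<Longrightarrow>
     cw_constructible k
       \<lparr>pverts = pverts G \<union> pverts H, parcs = parcs G \<union> parcs H\<rparr>
       (\<lambda>x. if x \<in> pverts G then l x else m x)"
| join:
    "cw_constructible k G l \<Longrightarrow> i < k \<Longrightarrow> j < k \<Longrightarrow> i \<noteq> j \<Longrightarrow>
     cw_constructible k
       \<lparr>pverts = pverts G,
        parcs = parcs G \<union> {(u, v). u \<in> pverts G \<and> v \<in> pverts G \<and>
                                  (l u = i \<and> l v = j \<or> l u = j \<and> l v = i)}\<rparr>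
       l"
| relabel:
    "cw_constructible k G l \<Longrightarrow> i < k \<Longrightarrow> j < k \<Longrightarrow>
     cw_constructible k G (\<lambda>x. if l x = i then j else l x)"

text \<open>The null graph is not built by these operations; it has clique-width 0 by convention.\<close>

definition clique_width :: "'a pair_pre_digraph \<Rightarrow> nat" where
  "clique_width G = (if pverts G = {} then 0 else (LEAST k. \<exists>l. cw_constructible k G l))"

definition unbounded_clique_width :: "'a pair_pre_digraph set \<Rightarrow> bool" where
  "unbounded_clique_width C \<longleftrightarrow> \<not> (\<exists>k. \<forall>G\<in>C. clique_width G \<le> k)"

text \<open>
  Since \<^const>\<open>ind_subgraph\<close> is up to isomorphism, a hereditary class is in particular closed under
  isomorphism.
\<close>

definition hereditary :: "'a pair_pre_digraph set \<Rightarrow> bool" where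
  "hereditary C \<longleftrightarrow> (\<forall>G\<in>C. pair_graph G) \<and> (\<forall>G\<in>C. \<forall>H. pair_graph H \<and> ind_subgraph H G \<longrightarrow> H \<in> C)"

definition HUCW :: "'a pair_pre_digraph set \<Rightarrow> bool" where
  "HUCW C \<longleftrightarrow> hereditary C \<and> unbounded_clique_width C"

definition minimal_HUCW :: "'a pair_pre_digraph set \<Rightarrow> bool" where
  "minimal_HUCW C \<longleftrightarrow> HUCW C \<and> \<not> (\<exists>D. D \<subset> C \<and> HUCW D)"

definition ind_subgraph_antichain :: "'a pair_pre_digraph set \<Rightarrow> bool" where
  "ind_subgraph_antichain A \<longleftrightarrow> (\<forall>G\<in>A. \<forall>H\<in>A. G \<noteq> H \<longrightarrow> \<not> ind_subgraph G H)"

end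

theory Submission
  imports Defs
begin

text \<open>
  If the \<open>HUCW\<close> subclasses of \<open>C\<close> have no minimal element, Zorn's lemma yields a chain of them whose
  intersection has clique-width at most some \<open>k\<close>. A graph \<open>G\<close> of clique-width above \<open>k\<close> is excluded
  from some member \<open>D\<close> of the chain, hence is no induced subgraph of any graph in \<open>D\<close>; and a graph
  in \<open>D\<close> whose clique-width exceeds that of the finitely many induced subgraphs of \<open>G\<close> is not
  an induced subgraph of \<open>G\<close>. Iterating produces the antichain.
\<close>

text \<open>The same expression builds the image, because each operation commutes with an injective
  renaming of the vertices. The induction must carry the agreement of labels, since joins and
  relabellings depend on them. The labelling \<open>m\<close> is existential because its values
  outside the image are left free.\<close>

lemma cw_constructible_map:
  assumes "cw_constructible k G l" "inj_on f (pverts G)"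
  shows "\<exists>m. cw_constructible k \<lparr>pverts = f ` pverts G, parcs = map_prod f f ` parcs G\<rparr> m \<and>
             (\<forall>x\<in>pverts G. m (f x) = l x)"
  using assms
proof (induction rule: cw_constructible.induct)
  case (create i v)
  then show ?case
    using cw_constructible.create[of i k "f v"] by auto
next
  case (disjoint_union G l H m)
  have inj: "inj_on f (pverts G \<union> pverts H)"
    using disjoint_union.prems by simp
  obtain l' where l': "cw_constructible k \<lparr>pverts = f ` pverts G, parcs = map_prod f f ` parcs G\<rparr> l'"
      "\<forall>x\<in>pverts G. l' (f x) = l x"
    using disjoint_union.IH(1) inj by (auto simp: inj_on_Un)
  obtain m' where m': "cw_constructible k \<lparr>pverts = f ` pverts H, parcs = map_prod f f ` parcs H\<rparr> m'"
      "\<forall>x\<in>pverts H. m' (f x) = m x"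
    using disjoint_union.IH(2) inj by (auto simp: inj_on_Un)
  have "f ` pverts G \<inter> f ` pverts H = {}"
    using inj disjoint_union.hyps by (auto dest!: inj_onD)
  then have "cw_constructible k
      \<lparr>pverts = f ` (pverts G \<union> pverts H), parcs = map_prod f f ` (parcs G \<union> parcs H)\<rparr>
      (\<lambda>x. if x \<in> f ` pverts G then l' x else m' x)"
    using cw_constructible.disjoint_union[OF l'(1) m'(1)] by (simp add: image_Un)
  \<comment> \<open>Needed so that the combined labelling takes its else branch on the image of
    \<open>H\<close>.\<close>
  moreover have "f x \<notin> f ` pverts G" if "x \<in> pverts H" for x
    using \<open>f ` pverts G \<inter> f ` pverts H = {}\<close> that by blast
  ultimately show ?case
    using l'(2) m'(2) disjoint_union.hyps(3)
    by (intro exI[of _ "\<lambda>x. if x \<in> f ` pverts G then l' x else m' x"]) auto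
next
  case (join G l i j)
  obtain m where m: "cw_constructible k \<lparr>pverts = f ` pverts G, parcs = map_prod f f ` parcs G\<rparr> m"
      "\<forall>x\<in>pverts G. m (f x) = l x"
    using join.IH join.prems by auto
  \<comment> \<open>The arcs added by the join. As \<open>m\<close> agrees with \<open>l\<close>
    along \<open>f\<close>, joining the image adds exactly the image of \<open>J\<close>.\<close>
  define J where "J = {(u, v). u \<in> pverts G \<and> v \<in> pverts G \<and>
    (l u = i \<and> l v = j \<or> l u = j \<and> l v = i)}"
  have "{(u, v). u \<in> f ` pverts G \<and> v \<in> f ` pverts G \<and> (m u = i \<and> m v = j \<or> m u = j \<and> m v = i)}
      = map_prod f f ` J" (is "?J' = _")
  proof (intro equalityI subsetI)
    fix z assume "z \<in> ?J'"
    then obtain u v where uv: "z = (f u, f v)" "u \<in> pverts G" "v \<in> pverts G"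
        "m (f u) = i \<and> m (f v) = j \<or> m (f u) = j \<and> m (f v) = i"
      by blast
    then have "(u, v) \<in> J" using m(2) by (simp add: J_def)
    then show "z \<in> map_prod f f ` J" using uv(1) by force
  next
    fix z assume "z \<in> map_prod f f ` J"
    then obtain u v where "z = (f u, f v)" "(u, v) \<in> J" by auto
    then show "z \<in> ?J'" using m(2) unfolding J_def by simp
  qed
  with cw_constructible.join[OF m(1) join.hyps(2-4)]
  have "cw_constructible k \<lparr>pverts = f ` pverts G, parcs = map_prod f f ` (parcs G \<union> J)\<rparr> m"
    by (simp only: image_Un pair_pre_digraph.simps)
  then show ?case
    using m(2) unfolding J_def[symmetric] by auto
next
  case (relabel G l i j)
  obtain m where m: "cw_constructible k \<lparr>pverts = f ` pverts G, parcs = map_prod f f ` parcs G\<rparr> m"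
      "\<forall>x\<in>pverts G. m (f x) = l x"
    using relabel.IH relabel.prems by auto
  show ?case
    using cw_constructible.relabel[OF m(1) relabel.hyps(2,3)] m(2)
    by (intro exI[of _ "\<lambda>x. if m x = i then j else m x"]) simp
qed

text \<open>An isomorphism of general digraphs has a separate map on arcs. Here tail and head are
  \<open>fst\<close> and \<open>snd\<close> on both sides, so the vertex map determines it.\<close>

lemma digraph_iso_with_projE:
  assumes "digraph_iso (with_proj G) (with_proj H)"
  obtains f where "inj_on f (pverts G)" "H = \<lparr>pverts = f ` pverts G, parcs = map_prod f f ` parcs G\<rparr>"
proof -
  obtain h where h: "pre_digraph.digraph_isomorphism (with_proj G) h" "with_proj H = app_iso h (with_proj G)"
    using assms by (auto simp: digraph_iso_def)
  have eq: "pverts H = iso_verts h ` pverts G" "parcs H = iso_arcs h ` parcs G"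
      "iso_tail h = fst" "iso_head h = snd"
    using h(2) by (simp_all add: with_proj_def app_iso_def)
  have inj: "inj_on (iso_verts h) (pverts G)"
    and ends: "\<forall>a\<in>parcs G. iso_arcs h a = map_prod (iso_verts h) (iso_verts h) a"
    using h(1) eq(3,4) by (auto simp: pre_digraph.digraph_isomorphism_def prod_eq_iff)
  have "parcs H = map_prod (iso_verts h) (iso_verts h) ` parcs G"
    using eq(2) ends by simp
  then show thesis
    using that[OF inj] eq(1) by simp
qed

lemma clique_width_iso:
  fixes G H :: "'a pair_pre_digraph"
  assumes "digraph_iso (with_proj G) (with_proj H)"
  shows "clique_width G = clique_width H"
proof -
  have constr: "\<exists>m. cw_constructible k K' m"
    if iso: "digraph_iso (with_proj K) (with_proj K')" and K: "cw_constructible k K l"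
    for k l and K K' :: "'a pair_pre_digraph"
  proof -
    obtain f where f: "inj_on f (pverts K)" "K' = \<lparr>pverts = f ` pverts K, parcs = map_prod f f ` parcs K\<rparr>"
      using iso by (rule digraph_iso_with_projE)
    show ?thesis
      using cw_constructible_map[OF K f(1)] unfolding f(2) by blast
  qed
  have sym: "digraph_iso (with_proj H) (with_proj G)"
    using assms by (rule digraph_iso_swap[rotated])
      (use assms in \<open>auto simp: digraph_iso_def pre_digraph.digraph_isomorphism_def\<close>)
  have "(\<exists>l. cw_constructible k G l) \<longleftrightarrow> (\<exists>l. cw_constructible k H l)" for k
    using constr[OF assms] constr[OF sym] by blast
  moreover have "pverts G = {} \<longleftrightarrow> pverts H = {}"
    using assms by (elim digraph_iso_with_projE) simp
  ultimately show ?thesis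
    by (simp add: clique_width_def)
qed

text \<open>Up to isomorphism a finite graph has only finitely many induced subgraphs, and
  clique-width is invariant under isomorphism.\<close>

lemma bounded_clique_width_ind_subgraphs:
  fixes G :: "'a pair_pre_digraph"
  assumes "pair_graph G"
  obtains b where "clique_width G \<le> b" "\<And>H. ind_subgraph H G \<Longrightarrow> clique_width H \<le> b"
proof -
  interpret pair_graph G by fact
  \<comment> \<open>A crude finite superset of the induced subgraphs lying inside \<open>G\<close>;
    its members need be neither induced nor well-formed.\<close>
  let ?S = "{H :: 'a pair_pre_digraph. pverts H \<subseteq> pverts G \<and> parcs H \<subseteq> parcs G}"
  have "?S \<subseteq> (\<lambda>(V, E). \<lparr>pverts = V, parcs = E\<rparr>) ` (Pow (pverts G) \<times> Pow (parcs G))"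
  proof
    fix H assume "H \<in> ?S"
    then show "H \<in> (\<lambda>(V, E). \<lparr>pverts = V, parcs = E\<rparr>) ` (Pow (pverts G) \<times> Pow (parcs G))"
      by (intro image_eqI[of _ _ "(pverts H, parcs H)"]) auto
  qed
  then have fin: "finite (clique_width ` ?S)"
    by (intro finite_imageI) (auto elim!: finite_subset simp: pair_finite_verts pair_finite_arcs)
  show thesis
  proof (rule that)
    show "clique_width G \<le> Max (clique_width ` ?S)"
      using fin by (intro Max_ge) auto
    fix H assume "ind_subgraph H G"
    then obtain H' where "induced_subgraph (with_proj H') (with_proj G)"
        "digraph_iso (with_proj H) (with_proj H')"
      unfolding ind_subgraph_def by blast
    then have "H' \<in> ?S" "clique_width H = clique_width H'"
      using clique_width_iso by (auto simp: induced_subgraph_def subgraph_def)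
    then show "clique_width H \<le> Max (clique_width ` ?S)"
      using fin by (intro Max_ge) auto
  qed
qed

lemma hereditary_Inter:
  assumes "\<D> \<noteq> {}" "\<forall>D\<in>\<D>. hereditary D"
  shows "hereditary (\<Inter>\<D>)"
  using assms unfolding hereditary_def by blast

lemma antichain_of_chain_bounded_Inter:
  fixes \<D> :: "'a pair_pre_digraph set set"
  assumes ne: "\<D> \<noteq> {}" and hucw: "\<forall>D\<in>\<D>. HUCW D"
    and chain: "\<forall>D\<in>\<D>. \<forall>E\<in>\<D>. D \<subseteq> E \<or> E \<subseteq> D"
    and bdd: "\<not> unbounded_clique_width (\<Inter>\<D>)"
  shows "\<exists>A \<subseteq> \<Union>\<D>. ind_subgraph_antichain A \<and> unbounded_clique_width A"
proof -
  obtain k where k: "\<forall>G\<in>\<Inter>\<D>. clique_width G \<le> k"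
    using bdd unfolding unbounded_clique_width_def by blast
  \<comment> \<open>A state records a class of the chain, a graph chosen from it, and a bound for
    that graph and all its induced subgraphs.\<close>
  define P where "P = (\<lambda>(D, G, b). D \<in> \<D> \<and> G \<in> D \<and> k < clique_width G \<and> clique_width G \<le> b \<and>
      (\<forall>H. ind_subgraph H G \<longrightarrow> clique_width H \<le> b))"
  \<comment> \<open>Leaving \<open>G\<close> out of \<open>D'\<close> will prevent \<open>G\<close>
    from embedding into later graphs; exceeding \<open>b\<close> prevents later graphs from
    embedding into \<open>G\<close>.\<close>
  define Q where "Q = (\<lambda>(D, G :: 'a pair_pre_digraph, b :: nat) (D', G' :: 'a pair_pre_digraph, b' :: nat).
      D' \<subseteq> D \<and> G \<notin> D' \<and> b < clique_width G')"
  have pick: "\<exists>G b'. P (D, G, b') \<and> b < clique_width G" if "D \<in> \<D>" for D b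
  proof -
    have "HUCW D" using hucw that by blast
    then obtain G where G: "G \<in> D" "max k b < clique_width G" "pair_graph G"
      unfolding HUCW_def unbounded_clique_width_def hereditary_def by (meson not_le)
    obtain b' where "clique_width G \<le> b'" "\<And>H. ind_subgraph H G \<Longrightarrow> clique_width H \<le> b'"
      using bounded_clique_width_ind_subgraphs[OF G(3)] by blast
    with G that show ?thesis by (auto simp: P_def)
  qed
  have "\<exists>f. \<forall>n. P (f n) \<and> Q (f n) (f (Suc n))"
  proof (rule dependent_nat_choice)
    show "\<exists>x. P x" using ne pick by blast
    fix x assume "P x"
    obtain D G b where x: "x = (D, G, b)" by (cases x)
    have D: "D \<in> \<D>" "G \<in> D" "k < clique_width G"
      using \<open>P x\<close> by (auto simp: x P_def)
    \<comment> \<open>Clique-width above \<open>k\<close> keeps \<open>G\<close> out of the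
      intersection. As \<open>G\<close> lies in \<open>D\<close> but not in \<open>E\<close>,
      comparability then forces \<open>E\<close> below \<open>D\<close>.\<close>
    then obtain E where E: "E \<in> \<D>" "G \<notin> E"
      using k by (meson InterI not_le)
    then have "E \<subseteq> D" using chain D by blast
    moreover obtain G' b' where "P (E, G', b')" "b < clique_width G'"
      using pick[OF E(1)] by blast
    ultimately show "\<exists>y. P y \<and> Q x y"
      using E by (auto simp: x Q_def)
  qed
  then obtain f where f: "P (f n)" "Q (f n) (f (Suc n))" for n by blast
  define D where "D n = fst (f n)" for n
  define G where "G n = fst (snd (f n))" for n
  define b where "b n = snd (snd (f n))" for n
  have f_eq: "f n = (D n, G n, b n)" for n
    by (simp add: D_def G_def b_def)
  have P: "D n \<in> \<D>" "G n \<in> D n" "clique_width (G n) \<le> b n"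
      "ind_subgraph H (G n) \<Longrightarrow> clique_width H \<le> b n" for n H
    using f(1)[of n] by (auto simp: f_eq P_def)
  have Q: "D (Suc n) \<subseteq> D n" "G n \<notin> D (Suc n)" "b n < clique_width (G (Suc n))" for n
    using f(2)[of n] by (auto simp: f_eq Q_def)
  have b_mono: "strict_mono b"
    unfolding strict_mono_Suc_iff using less_le_trans[OF Q(3) P(3)] by simp
  have not_up: "\<not> ind_subgraph (G i) (G j)" if "i < j" for i j
  proof
    assume sub: "ind_subgraph (G i) (G j)"
    \<comment> \<open>\<open>Suc i\<close> is the first stage whose class omits \<open>G i\<close>;
      being hereditary, that class cannot contain a graph with \<open>G i\<close> inside.\<close>
    have "D j \<subseteq> D (Suc i)"
      by (rule lift_Suc_antimono_le[of D, OF Q(1)]) (use that in simp)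
    then have "G j \<in> D (Suc i)" using P(2) by blast
    moreover have "hereditary (D n)" for n using hucw P(1) by (auto simp: HUCW_def)
    ultimately have "G i \<in> D (Suc i)"
      using sub P(2) unfolding hereditary_def by blast
    then show False using Q(2) by blast
  qed
  have not_down: "\<not> ind_subgraph (G j) (G i)" if "i < j" for i j
  proof
    assume sub: "ind_subgraph (G j) (G i)"
    \<comment> \<open>\<open>Q\<close> compares consecutive stages only, so the bound is first
      raised from \<open>b i\<close> to that of the predecessor of \<open>j\<close>.\<close>
    obtain j' where j': "j = Suc j'" "i \<le> j'"
      using \<open>i < j\<close> by (cases j) auto
    have "clique_width (G j) \<le> b i" using sub by (rule P(4))
    also
    have "b i \<le> b j'" using b_mono j'(2) by (simp add: strict_mono_less_eq)
    also have "\<dots> < clique_width (G j)" using Q(3) j'(1) by simp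
    finally show False by simp
  qed
  have "ind_subgraph_antichain (range G)"
    unfolding ind_subgraph_antichain_def using not_up not_down by (metis linorder_neqE_nat rangeE)
  moreover have "n < clique_width (G (Suc n))" for n
    using strict_mono_imp_increasing[OF b_mono, of n] Q(3)[of n] by simp
  then have "unbounded_clique_width (range G)"
    unfolding unbounded_clique_width_def by (meson not_le rangeI)
  moreover have "range G \<subseteq> \<Union>\<D>" using P by blast
  ultimately show ?thesis by blast
qed

theorem theorem2:
  fixes C :: "nat pair_pre_digraph set"
  assumes "HUCW C"
    and "\<not> (\<exists>D. D \<subseteq> C \<and> minimal_HUCW D)"
  shows "\<exists>A. A \<subseteq> C \<and> ind_subgraph_antichain A \<and> unbounded_clique_width A"
proof (rule ccontr)
  assume no_antichain: "\<not> ?thesis"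
  let ?S = "{D. D \<subseteq> C \<and> HUCW D}"
  \<comment> \<open>The order is reversed inclusion, so Zorn's maximal element is a minimal class
    and upper bounds of chains are lower bounds for inclusion.\<close>
  let ?R = "relation_of (\<lambda>D E. E \<subseteq> D) ?S"
  have "\<exists>M\<in>?S. \<forall>D\<in>?S. D \<subseteq> M \<longrightarrow> D = M"
  proof (rule predicate_Zorn)
    show "partial_order_on ?S ?R"
      by (rule partial_order_on_relation_ofI) auto
    fix \<D> assume "\<D> \<in> Chains ?R"
    then have \<D>: "\<D> \<subseteq> ?S" "\<forall>D\<in>\<D>. \<forall>E\<in>\<D>. D \<subseteq> E \<or> E \<subseteq> D"
      by (auto simp: Chains_def relation_of_def)
    show "\<exists>u\<in>?S. \<forall>D\<in>\<D>. u \<subseteq> D"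
    proof (cases "\<D> = {}")
      case True
      \<comment> \<open>The empty intersection would be the whole universe, so \<open>C\<close>
        itself serves as the bound.\<close>
      then show ?thesis using assms(1) by auto
    next
      case False
      have "unbounded_clique_width (\<Inter>\<D>)"
      proof (rule ccontr)
        assume "\<not> unbounded_clique_width (\<Inter>\<D>)"
        then obtain A where "A \<subseteq> \<Union>\<D>" "ind_subgraph_antichain A" "unbounded_clique_width A"
          using antichain_of_chain_bounded_Inter[OF False _ \<D>(2)] \<D>(1) by blast
        moreover have "\<Union>\<D> \<subseteq> C" using \<D>(1) by blast
        ultimately show False using no_antichain by blast
      qed
      moreover have "hereditary (\<Inter>\<D>)"
        using \<D>(1) by (intro hereditary_Inter False) (auto simp: HUCW_def)
      ultimately have "\<Inter>\<D> \<in> ?S"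
        using \<D>(1) False by (auto simp: HUCW_def)
      then show ?thesis by blast
    qed
  qed
  then obtain M where M: "M \<subseteq> C" "HUCW M" "\<And>D. D \<subseteq> C \<Longrightarrow> HUCW D \<Longrightarrow> D \<subseteq> M \<Longrightarrow> D = M"
    by auto
  \<comment> \<open>Minimality within \<open>?S\<close> suffices, as every subclass of
    \<open>M\<close> is also a subclass of \<open>C\<close>.\<close>
  have "minimal_HUCW M"
    unfolding minimal_HUCW_def
  proof (intro conjI notI)
    assume "\<exists>D. D \<subset> M \<and> HUCW D"
    then obtain D where "D \<subset> M" "HUCW D" by blast
    with M(1) M(3)[of D] show False by auto
  qed (fact M(2))
  with M(1) assms(2) show False by blast
qed

end
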